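(* Let $h \in \Gamma_0(\mathbb{R}^N)$ be separable, i.e. $h(x) = \sum_{i=1}^N h_i(x_i)$ with each $h_i\in\Gamma_0(\mathbb{R})$, and let $V = D + uu^T$, where $D \in \mathbb{R}^{N\times N}$ is diagonal with strictly positive diagonal elements $d_1,\dots,d_N$ and $u \in \mathbb{R}^N$. Then for every $x \in \mathbb{R}^N$, $$\operatorname{prox}^V_h(x) = \Big(\operatorname{prox}_{h_i/d_i}\big(x_i - v_i/d_i\big)\Big)_{1\le i\le N},$$ where $v = \alpha^\star u$ and $\alpha^\star\in\mathbb{R}$ is the unique root of the function $p:\mathbb{R}\to\mathbb{R}$ defined by $$p(\alpha) = \Big\langle u,\; x - \big(\operatorname{prox}_{h_i/d_i}(x_i - \alpha u_i/d_i)\big)_{1\le i\le N}\Big\rangle + \alpha,$$ which is a Lipschitz continuous and strictly increasing function on $\mathbb{R}$.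
   Context: $\mathbb{R}^N$ carries the usual Euclidean scalar product $\langle\cdot,\cdot\rangle$ and norm $\|\cdot\|$. $\Gamma_0(\mathbb{R}^n)$ is the class of proper lower semicontinuous convex functions from $\mathbb{R}^n$ to $\mathbb{R}\cup\{+\infty\}$. For $g\in\Gamma_0(\mathbb{R}^n)$, $\operatorname{prox}_g(x)$ denotes the unique minimizer of $z\mapsto \frac12\|x-z\|^2+g(z)$. For a symmetric positive-definite matrix $V$, $\|x\|_V = \sqrt{\langle x, Vx\rangle}$, and $\operatorname{prox}^V_g(x)$ denotes the unique minimizer of $z\mapsto\frac12\|x-z\|_V^2+g(z)$. *)

theory Defs
  imports "HOL-Analysis.Analysis"
begin

definition proper_fun :: "('a \<Rightarrow> ereal) \<Rightarrow> bool" where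
  "proper_fun f \<longleftrightarrow> (\<forall>x. f x \<noteq> -\<infinity>) \<and> (\<exists>x. f x \<noteq> \<infinity>)"

definition lsc_fun :: "('a::topological_space \<Rightarrow> ereal) \<Rightarrow> bool" where
  "lsc_fun f \<longleftrightarrow> (\<forall>x. f x \<le> Liminf (at x) f)"

(* The library's convex_on is restricted to real-valued functions. *)
definition convex_fun :: "('a::real_vector \<Rightarrow> ereal) \<Rightarrow> bool" where
  "convex_fun f \<longleftrightarrow>
     (\<forall>x y. \<forall>t. 0 < t \<and> t < 1 \<longrightarrow>
        f ((1 - t) *\<^sub>R x + t *\<^sub>R y) \<le> ereal (1 - t) * f x + ereal t * f y)"

definition Gamma0 :: "('a::euclidean_space \<Rightarrow> ereal) set" where
  "Gamma0 = {f. proper_fun f \<and> lsc_fun f \<and> convex_fun f}"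

definition prox :: "('a::euclidean_space \<Rightarrow> ereal) \<Rightarrow> 'a \<Rightarrow> 'a" where
  "prox g x =
     (THE z. is_arg_min (\<lambda>z. ereal (1 / 2 * (norm (x - z))\<^sup>2) + g z) (\<lambda>_. True) z)"

(* norm_V and prox_V are only meant for symmetric positive-definite V. *)
definition norm_V :: "real^'n^'n \<Rightarrow> real^'n \<Rightarrow> real" where
  "norm_V V x = sqrt (x \<bullet> (V *v x))"

definition prox_V :: "real^'n^'n \<Rightarrow> (real^'n \<Rightarrow> ereal) \<Rightarrow> real^'n \<Rightarrow> real^'n" where
  "prox_V V g x =
     (THE z. is_arg_min (\<lambda>z. ereal (1 / 2 * (norm_V V (x - z))\<^sup>2) + g z) (\<lambda>_. True) z)"

end

theory Submission
  imports Defs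
begin

text \<open>
  A point \<open>z\<close> is the proximal point of \<open>g\<close> at \<open>a\<close> exactly when the residual \<open>a - z\<close> is a
  subgradient of \<open>g\<close> at \<open>z\<close>, and in the metric of \<open>V\<close> it suffices that \<open>V (a - z)\<close> is one
  (\<open>Gamma0_prox_subgradient\<close>, \<open>prox_eqI\<close>, \<open>prox_V_eqI\<close>).  For separable \<open>h\<close>, subgradients can be
  assembled coordinate by coordinate (\<open>subgradient_separable\<close>).

  With \<open>V = D + u u\<^sup>T\<close> the residual is \<open>V (x - z) = D (x - z) + \<langle>u, x - z\<rangle> u\<close>.  The coordinates are
  coupled only through the scalar \<open>\<langle>u, x - z\<rangle>\<close>.  Replace this scalar by a parameter \<open>- \<alpha>\<close>.
  Then the condition in coordinate \<open>i\<close> says that \<open>d\<^sub>i (x\<^sub>i - \<alpha> u\<^sub>i / d\<^sub>i - z\<^sub>i)\<close> is a subgradient of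
  \<open>h\<^sub>i\<close> at \<open>z\<^sub>i\<close>, that is, \<open>z\<^sub>i\<close> is the proximal point of \<open>h\<^sub>i / d\<^sub>i\<close> at \<open>x\<^sub>i - \<alpha> u\<^sub>i / d\<^sub>i\<close>.  The
  replacement is consistent when \<open>\<langle>u, x - z\<rangle> + \<alpha> = 0\<close>, and this is the equation \<open>p \<alpha> = 0\<close>.

  Proximal maps are firmly nonexpansive (\<open>prox_firmly_nonexpansive\<close>), because subgradients are
  monotone.  Hence each term \<open>- u\<^sub>i z\<^sub>i(\<alpha>)\<close> of \<open>p\<close> is nondecreasing and has Lipschitz constant
  \<open>u\<^sub>i\<^sup>2 / d\<^sub>i\<close>.  Together with the summand \<open>\<alpha>\<close> this makes \<open>p\<close> Lipschitz and of slope at least 1,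
  so that \<open>p\<close> takes both signs and has exactly one root.

  Proximal points exist because a proper convex lower semicontinuous function decreases at most linearly
  (\<open>Gamma0_conic_minorant\<close>): the quadratic term dominates far away, and lower semicontinuity gives
  a minimum on the remaining ball.
\<close>

section \<open>Attainment for lower semicontinuous functions\<close>

lemma lsc_fun_open_superlevel:
  fixes f :: "'a::topological_space \<Rightarrow> ereal"
  assumes "lsc_fun f"
  shows "open {z. c < f z}"
proof -
  have "eventually (\<lambda>z. c < f z) (nhds x)" if "c < f x" for x
  proof -
    have "eventually (\<lambda>z. c < f z) (at x)"
      using assms that unfolding lsc_fun_def le_Liminf_iff by blast
    with that show ?thesis by (auto simp: eventually_at_filter elim: eventually_mono)
  qed
  then have "\<exists>T. open T \<and> x \<in> T \<and> T \<subseteq> {z. c < f z}" if "c < f x" for x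
    using that unfolding eventually_nhds subset_eq mem_Collect_eq .
  then show ?thesis by (subst open_subopen) simp
qed

text \<open>
  If no point of \<open>K\<close> were a minimizer, the strict superlevel sets of the values taken on \<open>K\<close>
  would cover \<open>K\<close>.  A finite subcover has a smallest value, and no set of the subcover
  contains the point that takes it.
\<close>

lemma open_superlevel_attains_min:
  fixes f :: "'a::topological_space \<Rightarrow> 'b::linorder"
  assumes "compact K" "K \<noteq> {}" and op: "\<And>c. open {z. c < f z}"
  shows "\<exists>y\<in>K. \<forall>z\<in>K. f y \<le> f z"
proof (rule ccontr)
  assume "\<not> ?thesis"
  then have cover: "K \<subseteq> (\<Union>y\<in>K. {z. f y < f z})" by (auto simp: not_le)
  obtain C where C: "C \<subseteq> K" "finite C" "K \<subseteq> (\<Union>y\<in>C. {z. f y < f z})"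
    using compactE_image[OF assms(1) _ cover] op by blast
  have "C \<noteq> {}" using C assms(2) by auto
  then obtain y where "y \<in> C" "\<And>z. z \<in> C \<Longrightarrow> f y \<le> f z"
    using arg_min_if_finite[OF C(2), of f] by (meson not_le)
  with C show False by force
qed

lemma open_superlevel_add_continuous:
  fixes q :: "'a::topological_space \<Rightarrow> real" and g :: "'a \<Rightarrow> ereal"
  assumes q: "continuous_on UNIV q" and g: "\<And>c. open {z. c < g z}"
  shows "open {z. c < ereal (q z) + g z}"
proof -
  \<comment> \<open>A real level \<open>r\<close> for \<open>g\<close> can be inserted strictly between \<open>c - q z\<close> and \<open>g z\<close>.\<close>
  have eq: "{z. c < ereal (q z) + g z} = (\<Union>r::real. {z. c < ereal (q z + r)} \<inter> {z. ereal r < g z})"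
  proof (intro set_eqI iffI)
    fix z assume "z \<in> {z. c < ereal (q z) + g z}"
    then have "c - ereal (q z) < g z" by (cases c; cases "g z") auto
    then obtain r where "c - ereal (q z) < ereal r" "ereal r < g z"
      using ereal_dense2 by blast
    then show "z \<in> (\<Union>r::real. {z. c < ereal (q z + r)} \<inter> {z. ereal r < g z})"
      by (cases c) (auto intro!: exI[of _ r])
  next
    fix z assume "z \<in> (\<Union>r::real. {z. c < ereal (q z + r)} \<inter> {z. ereal r < g z})"
    then show "z \<in> {z. c < ereal (q z) + g z}"
      by (cases c; cases "g z") auto
  qed
  have "open {z. c < ereal (q z + r)}" for r
    by (intro open_Collect_less continuous_intros q)
  with g show ?thesis unfolding eq by blast
qed

section \<open>Existence of proximal points\<close>

lemma Gamma0_open_superlevel: "g \<in> Gamma0 \<Longrightarrow> open {z. c < g z}"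
  by (simp add: Gamma0_def lsc_fun_open_superlevel)

text \<open>
  On the unit ball around \<open>y\<close> semicontinuity provides the lower bound \<open>m\<close>.  A point \<open>z\<close> outside
  the ball is joined to \<open>y\<close> by a segment that meets the unit sphere.  By convexity, if \<open>g z\<close> were
  below \<open>g y - (g y - m) \<parallel>z - y\<parallel>\<close>, then \<open>g\<close> would be below \<open>m\<close> at the point of the sphere.
\<close>

lemma Gamma0_conic_minorant:
  fixes g :: "'a::euclidean_space \<Rightarrow> ereal"
  assumes g: "g \<in> Gamma0" and r: "g y = ereal r"
  shows "\<exists>m c. 0 \<le> c \<and> (\<forall>z. ereal (m - c * norm (z - y)) \<le> g z)"
proof -
  have "cball y 1 \<noteq> {}" by simp
  then obtain w where w: "\<And>z. z \<in> cball y 1 \<Longrightarrow> g w \<le> g z"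
    using open_superlevel_attains_min[OF compact_cball _ Gamma0_open_superlevel[OF g]] by meson
  have nm: "g z \<noteq> -\<infinity>" for z using g by (auto simp: Gamma0_def proper_fun_def)
  have "g w \<le> ereal r" using w[of y] r by simp
  then obtain m where m: "g w = ereal m" "m \<le> r" using nm[of w] by (cases "g w") auto
  have "ereal (m - (r - m) * norm (z - y)) \<le> g z" for z
  proof (cases "norm (z - y) \<le> 1")
    case True
    then have "ereal m \<le> g z" using w[of z] m by (simp add: dist_norm norm_minus_commute)
    moreover have "m - (r - m) * norm (z - y) \<le> m" using m by simp
    ultimately show ?thesis by (meson ereal_less_eq(3) order_trans)
  next
    case False
    define t where "t = 1 / norm (z - y)"
    have t: "0 < t" "t < 1" "t * norm (z - y) = 1" using False by (auto simp: t_def divide_less_eq_1)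
    let ?v = "(1 - t) *\<^sub>R y + t *\<^sub>R z"
    have "?v - y = t *\<^sub>R (z - y)" by (simp add: algebra_simps)
    then have "norm (?v - y) = 1" using t by simp
    then have "ereal m \<le> g ?v" using w[of ?v] m by (simp add: dist_norm norm_minus_commute)
    also have "\<dots> \<le> ereal (1 - t) * g y + ereal t * g z"
      using g t by (auto simp: Gamma0_def convex_fun_def)
    finally have conv: "ereal m \<le> ereal (1 - t) * g y + ereal t * g z" .
    show ?thesis
    proof (cases "g z")
      case (real s)
      then have "m \<le> (1 - t) * r + t * s" using conv r by simp
      then have "(m - r) \<le> t * (s - r)" by (simp add: algebra_simps)
      then have "(m - r) * norm (z - y) \<le> t * (s - r) * norm (z - y)"
        by (rule mult_right_mono) simp
      also have "\<dots> = s - r" using t(3) by (simp add: mult.commute mult.left_commute)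
      finally have "m - (r - m) * norm (z - y) \<le> s" using m by (simp add: algebra_simps)
      then show ?thesis using real by simp
    qed (use nm in auto)
  qed
  with m show ?thesis by (intro exI[of _ m] exI[of _ "r - m"]) auto
qed

lemma quadratic_eventually_above:
  fixes c m K :: real
  assumes "0 \<le> c"
  shows "\<exists>R\<ge>0. \<forall>s>R. K < 1 / 2 * s\<^sup>2 + (m - c * (s + b))"
proof -
  \<comment> \<open>The claim is equivalent to \<open>2 e < s (s - 2 c)\<close>; the radius makes the second factor at least 1.\<close>
  define e where "e = K - m + c * b"
  define R where "R = 2 * c + 1 + 2 * \<bar>e\<bar>"
  have "K < 1 / 2 * s\<^sup>2 + (m - c * (s + b))" if "s > R" for s
  proof -
    have "2 * e < s" "0 < s" "1 \<le> s - 2 * c" using that assms by (auto simp: R_def)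
    then have "2 * e < s * (s - 2 * c)"
      using mult_left_mono[of 1 "s - 2 * c" s] by linarith
    then show ?thesis by (simp add: e_def power2_eq_square algebra_simps)
  qed
  then show ?thesis using assms by (intro exI[of _ R]) (auto simp: R_def)
qed

lemma Gamma0_prox_objective_attains_min:
  fixes g :: "'a::euclidean_space \<Rightarrow> ereal" and a :: 'a
  assumes g: "g \<in> Gamma0"
  defines "F \<equiv> \<lambda>z. ereal (1 / 2 * (norm (a - z))\<^sup>2) + g z"
  shows "\<exists>p. \<forall>z. F p \<le> F z"
proof -
  obtain y where "g y \<noteq> \<infinity>" "g y \<noteq> -\<infinity>" using g by (auto simp: Gamma0_def proper_fun_def)
  then obtain r where r: "g y = ereal r" by (cases "g y") auto
  obtain m c where c: "0 \<le> c" and mc: "\<And>z. ereal (m - c * norm (z - y)) \<le> g z"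
    using Gamma0_conic_minorant[OF g r] by blast
  define K where "K = 1 / 2 * (norm (a - y))\<^sup>2 + r"
  have Fy: "F y = ereal K" by (simp add: F_def K_def r)
  obtain R where R: "R \<ge> 0" "\<And>s. s > R \<Longrightarrow> K < 1 / 2 * s\<^sup>2 + (m - c * (s + norm (a - y)))"
    using quadratic_eventually_above[OF c] by blast
  \<comment> \<open>Outside the ball the objective exceeds its value at the reference point \<open>y\<close>.\<close>
  have far: "F y < F z" if "norm (a - z) > R" for z
  proof -
    have "norm (z - y) \<le> norm (a - z) + norm (a - y)"
      using norm_triangle_ineq4[of "a - y" "a - z"] by simp
    then have "m - c * (norm (a - z) + norm (a - y)) \<le> m - c * norm (z - y)"
      using c by (simp add: mult_left_mono)
    then have "ereal (m - c * (norm (a - z) + norm (a - y))) \<le> g z"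
      using mc[of z] by (meson ereal_less_eq(3) order_trans)
    then show ?thesis using R(2)[OF that] unfolding Fy by (cases "g z") (auto simp: F_def)
  qed
  have op: "open {z. k < F z}" for k
    unfolding F_def
    by (intro open_superlevel_add_continuous Gamma0_open_superlevel g continuous_intros)
  have "cball a R \<noteq> {}" using R(1) by auto
  then obtain p where p: "\<And>z. z \<in> cball a R \<Longrightarrow> F p \<le> F z"
    using open_superlevel_attains_min[OF compact_cball _ op, of a R] by blast
  have "F p \<le> F y"
  proof (cases "y \<in> cball a R")
    case False
    then have "F y < F y" using far[of y] by (simp add: dist_norm)
    then show ?thesis by simp
  qed (rule p)
  then have "F p \<le> F z" for z
    using p[of z] far[of z] by (cases "norm (a - z) > R") (auto simp: dist_norm)
  then show ?thesis by blast
qed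

section \<open>Subgradients and proximal points\<close>

text \<open>
  The finiteness requirement excludes an infinite value at \<open>p\<close>, for which the inequality
  holds trivially (value \<open>-\<infinity>\<close>) or forces \<open>g\<close> to be constantly \<open>\<infinity>\<close> (value \<open>\<infinity>\<close>).
\<close>

definition subgradient_at :: "('a::real_inner \<Rightarrow> ereal) \<Rightarrow> 'a \<Rightarrow> 'a \<Rightarrow> bool" where
  "subgradient_at g s p \<longleftrightarrow> \<bar>g p\<bar> \<noteq> \<infinity> \<and> (\<forall>z. g p + ereal (s \<bullet> (z - p)) \<le> g z)"

lemma the_arg_min_eqI:
  fixes F :: "'a \<Rightarrow> 'b::linorder"
  assumes "\<And>z. z \<noteq> p \<Longrightarrow> F p < F z"
  shows "(THE z. is_arg_min F (\<lambda>_. True) z) = p"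
proof (rule the_equality)
  show "is_arg_min F (\<lambda>_. True) p"
    unfolding is_arg_min_def using assms by (metis less_asym)
qed (use assms in \<open>auto simp: is_arg_min_def\<close>)

text \<open>
  Comparing objectives reduces to comparing real numbers, since the subgradient inequality lets
  an affine function stand for \<open>g\<close>.
\<close>

lemma subgradient_quadratic_strict_min:
  assumes sub: "subgradient_at g s p" and Q: "Q p < Q z + s \<bullet> (z - p)"
  shows "ereal (Q p) + g p < ereal (Q z) + g z"
proof -
  obtain r where r: "g p = ereal r" using sub by (auto simp: subgradient_at_def)
  have "ereal (r + s \<bullet> (z - p)) \<le> g z" using sub r by (auto simp: subgradient_at_def dest: spec[of _ z])
  with Q r show ?thesis by (cases "g z") auto
qed

text \<open>
  The linear term of the expansion of the square around \<open>p\<close> cancels against the affine minorant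
  given by the subgradient \<open>a - p\<close>; only the square of the distance from \<open>p\<close> is left, whence
  the strictness of the minimum.
\<close>

lemma half_norm_square_expand:
  fixes a p z :: "'a::real_inner"
  shows "1 / 2 * (norm (a - z))\<^sup>2 + (a - p) \<bullet> (z - p)
    = 1 / 2 * (norm (a - p))\<^sup>2 + 1 / 2 * (norm (z - p))\<^sup>2"
  unfolding power2_norm_eq_inner by (simp add: inner_diff inner_commute algebra_simps)

lemma prox_eqI:
  assumes "subgradient_at g (a - p) p"
  shows "prox g a = p"
  unfolding prox_def
proof (rule the_arg_min_eqI)
  fix z assume "z \<noteq> p"
  then have "0 < (norm (z - p))\<^sup>2" by simp
  then show "ereal (1 / 2 * (norm (a - p))\<^sup>2) + g p < ereal (1 / 2 * (norm (a - z))\<^sup>2) + g z"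
    using half_norm_square_expand[of a z p]
    by (intro subgradient_quadratic_strict_min[OF assms]) linarith
qed

text \<open>
  First-order optimality: move from \<open>p\<close> towards \<open>z\<close> by a fraction \<open>t\<close>.  Convexity bounds \<open>g\<close> on the
  segment, minimality bounds the objective from below, and dividing by \<open>t\<close> leaves the
  subgradient inequality up to an error of order \<open>t\<close>.
\<close>

lemma convex_minimizer_subgradient:
  fixes g :: "'a::euclidean_space \<Rightarrow> ereal"
  assumes g: "proper_fun g" "convex_fun g"
    and min: "\<And>z. ereal (1 / 2 * (norm (a - p))\<^sup>2) + g p \<le> ereal (1 / 2 * (norm (a - z))\<^sup>2) + g z"
  shows "subgradient_at g (a - p) p"
proof -
  have nm: "g z \<noteq> -\<infinity>" for z using g by (simp add: proper_fun_def)
  obtain y where "g y \<noteq> \<infinity>" using g by (auto simp: proper_fun_def)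
  then have "g p \<noteq> \<infinity>" using min[of y] nm[of y] by (cases "g y") auto
  then obtain r where r: "g p = ereal r" using nm[of p] by (cases "g p") auto
  have "ereal (r + (a - p) \<bullet> (z - p)) \<le> g z" for z
  proof (cases "g z")
    case (real s)
    let ?S = "(a - p) \<bullet> (z - p)" and ?N = "1 / 2 * (norm (z - p))\<^sup>2"
    have le: "r + ?S - t * ?N \<le> s" if t: "0 < t" "t < 1" for t
    proof -
      let ?v = "(1 - t) *\<^sub>R p + t *\<^sub>R z"
      have v: "?v - p = t *\<^sub>R (z - p)" by (simp add: algebra_simps)
      have "g ?v \<le> ereal (1 - t) * g p + ereal t * g z"
        using g t by (simp add: convex_fun_def)
      then have "g ?v \<le> ereal ((1 - t) * r + t * s)"
        using r real by simp
      then have "1 / 2 * (norm (a - p))\<^sup>2 + r \<le> 1 / 2 * (norm (a - ?v))\<^sup>2 + ((1 - t) * r + t * s)"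
        using min[of ?v] r by (cases "g ?v") auto
      moreover have "1 / 2 * (norm (a - ?v))\<^sup>2 = 1 / 2 * (norm (a - p))\<^sup>2 + t * (t * ?N) - t * ?S"
        using half_norm_square_expand[of a ?v p] unfolding v
        by (simp add: power_mult_distrib) (simp add: power2_eq_square)
      ultimately have "t * (r + ?S - t * ?N) \<le> t * s" by (simp add: algebra_simps)
      then show ?thesis using t by simp
    qed
    have "((\<lambda>t. r + ?S - t * ?N) \<longlongrightarrow> r + ?S - 0 * ?N) (at_right 0)"
      by (intro tendsto_intros)
    moreover have "eventually (\<lambda>t. r + ?S - t * ?N \<le> s) (at_right 0)"
      using le by (intro eventually_at_rightI[of 0 1]) auto
    ultimately have "r + ?S - 0 * ?N \<le> s"
      by (rule tendsto_upperbound) simp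
    then show ?thesis using real by simp
  qed (use nm in auto)
  with r show ?thesis by (simp add: subgradient_at_def)
qed

lemma Gamma0_prox_subgradient:
  assumes "g \<in> Gamma0"
  shows "subgradient_at g (a - prox g a) (prox g a)"
proof -
  obtain p where "subgradient_at g (a - p) p"
    using Gamma0_prox_objective_attains_min[OF assms] convex_minimizer_subgradient assms
    unfolding Gamma0_def by blast
  then show ?thesis using prox_eqI by metis
qed

lemma subgradient_monotone:
  assumes "subgradient_at g s p" "subgradient_at g t q"
  shows "0 \<le> (s - t) \<bullet> (p - q)"
proof -
  obtain a b where ab: "g p = ereal a" "g q = ereal b"
    using assms by (auto simp: subgradient_at_def)
  have "g p + ereal (s \<bullet> (q - p)) \<le> g q" "g q + ereal (t \<bullet> (p - q)) \<le> g p"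
    using assms by (auto simp: subgradient_at_def)
  then show ?thesis using ab by (simp add: inner_diff)
qed

text \<open>
  This is monotonicity of subgradients applied to the residuals \<open>a - prox g a\<close> and
  \<open>b - prox g b\<close>.
\<close>

lemma prox_firmly_nonexpansive:
  assumes "g \<in> Gamma0"
  shows "(norm (prox g a - prox g b))\<^sup>2 \<le> (a - b) \<bullet> (prox g a - prox g b)"
proof -
  have "0 \<le> ((a - prox g a) - (b - prox g b)) \<bullet> (prox g a - prox g b)"
    by (intro subgradient_monotone[of g] Gamma0_prox_subgradient assms)
  then show ?thesis by (simp add: power2_norm_eq_inner inner_diff algebra_simps)
qed

lemma prox_nonexpansive:
  assumes "g \<in> Gamma0"
  shows "norm (prox g a - prox g b) \<le> norm (a - b)"
proof -
  have "(norm (prox g a - prox g b))\<^sup>2 \<le> norm (a - b) * norm (prox g a - prox g b)"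
    using prox_firmly_nonexpansive[OF assms] norm_cauchy_schwarz order_trans by blast
  then show ?thesis
    by (cases "prox g a = prox g b") (auto simp: power2_eq_square)
qed

lemma Gamma0_divide:
  fixes g :: "'a::euclidean_space \<Rightarrow> ereal" and c :: real
  assumes g: "g \<in> Gamma0" and c: "0 < c"
  shows "(\<lambda>z. g z / ereal c) \<in> Gamma0"
proof -
  have nm: "g z \<noteq> -\<infinity>" for z using g by (simp add: Gamma0_def proper_fun_def)
  \<comment> \<open>In the description of the lower limit by strict lower bounds \<open>k\<close>, the factor moves onto \<open>k\<close>.\<close>
  have less: "k < e / ereal c \<longleftrightarrow> k * ereal c < e" for k e
    using c by (cases k; cases e) (auto simp: field_simps)
  have "proper_fun (\<lambda>z. g z / ereal c)"
  proof -
    have "g z / ereal c = -\<infinity> \<longleftrightarrow> g z = -\<infinity>" "g z / ereal c = \<infinity> \<longleftrightarrow> g z = \<infinity>" for z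
      using c by (cases "g z"; simp)+
    then show ?thesis using g by (simp add: Gamma0_def proper_fun_def)
  qed
  moreover have "lsc_fun (\<lambda>z. g z / ereal c)"
    using g unfolding Gamma0_def lsc_fun_def le_Liminf_iff less by simp
  moreover have "convex_fun (\<lambda>z. g z / ereal c)"
    unfolding convex_fun_def
  proof (intro allI impI)
    fix x y :: 'a and t :: real assume t: "0 < t \<and> t < 1"
    let ?v = "(1 - t) *\<^sub>R x + t *\<^sub>R y"
    have "g ?v \<le> ereal (1 - t) * g x + ereal t * g y"
      using g t by (auto simp: Gamma0_def convex_fun_def)
    then show "g ?v / ereal c \<le> ereal (1 - t) * (g x / ereal c) + ereal t * (g y / ereal c)"
      using c t nm[of x] nm[of y] nm[of ?v]
      by (cases "g ?v"; cases "g x"; cases "g y") (auto simp: field_simps)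
  qed
  ultimately show ?thesis by (simp add: Gamma0_def)
qed

lemma subgradient_divide_iff:
  fixes c :: real
  assumes "0 < c"
  shows "subgradient_at (\<lambda>z. g z / ereal c) s p \<longleftrightarrow> subgradient_at g (c *\<^sub>R s) p"
proof -
  have "g p / ereal c + ereal (s \<bullet> (z - p)) \<le> g z / ereal c
      \<longleftrightarrow> g p + ereal ((c *\<^sub>R s) \<bullet> (z - p)) \<le> g z" for z
  proof (cases "g p"; cases "g z")
    fix a b assume "g p = ereal a" "g z = ereal b"
    moreover have "a / c + s \<bullet> (z - p) \<le> b / c \<longleftrightarrow> a + c * (s \<bullet> (z - p)) \<le> b"
      using assms by (simp add: pos_le_divide_eq distrib_left mult.commute)
    ultimately show ?thesis using assms by simp
  qed (use assms in auto)
  moreover have "\<bar>g p / ereal c\<bar> = \<infinity> \<longleftrightarrow> \<bar>g p\<bar> = \<infinity>"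
    using assms by (cases "g p") auto
  ultimately show ?thesis by (simp add: subgradient_at_def)
qed

lemma subgradient_separable:
  fixes s p :: "real^'n"
  assumes "\<And>i. subgradient_at (hs i) (s $ i) (p $ i)"
  shows "subgradient_at (\<lambda>y. \<Sum>i\<in>UNIV. hs i (y $ i)) s p"
  unfolding subgradient_at_def
proof (intro conjI allI)
  show "\<bar>\<Sum>i\<in>UNIV. hs i (p $ i)\<bar> \<noteq> \<infinity>"
    using assms by (simp add: subgradient_at_def sum_Inf)
  fix z
  have "(\<Sum>i\<in>UNIV. hs i (p $ i)) + ereal (s \<bullet> (z - p))
      = (\<Sum>i\<in>UNIV. hs i (p $ i) + ereal (s $ i \<bullet> (z $ i - p $ i)))"
    by (simp add: sum.distrib inner_vec_def)
  also have "\<dots> \<le> (\<Sum>i\<in>UNIV. hs i (z $ i))"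
    using assms by (intro sum_mono) (simp add: subgradient_at_def)
  finally show "(\<Sum>i\<in>UNIV. hs i (p $ i)) + ereal (s \<bullet> (z - p)) \<le> (\<Sum>i\<in>UNIV. hs i (z $ i))" .
qed

section \<open>Scaled proximal points\<close>

text \<open>
  As for the Euclidean norm, symmetry of \<open>V\<close> lets the linear term of the expanded quadratic form
  cancel against the affine minorant, and positive definiteness makes the remaining term strict.
\<close>

lemma prox_V_eqI:
  fixes V :: "real^'n^'n"
  assumes sym: "transpose V = V" and pos: "\<And>y. y \<noteq> 0 \<Longrightarrow> 0 < y \<bullet> (V *v y)"
    and sub: "subgradient_at g (V *v (a - p)) p"
  shows "prox_V V g a = p"
  unfolding prox_V_def
proof (rule the_arg_min_eqI)
  have nn: "0 \<le> y \<bullet> (V *v y)" for y using pos[of y] by (cases "y = 0") auto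
  have nV: "(norm_V V y)\<^sup>2 = y \<bullet> (V *v y)" for y using nn[of y] by (simp add: norm_V_def)
  fix z assume "z \<noteq> p"
  define e w where "e = a - p" and "w = z - p"
  have az: "a - z = e - w" by (simp add: e_def w_def)
  have "e \<bullet> (V *v w) = w \<bullet> (V *v e)"
    by (metis dot_lmul_matrix inner_commute sym transpose_matrix_vector)
  then have "1 / 2 * (norm_V V (a - z))\<^sup>2 + (V *v e) \<bullet> w = 1 / 2 * (e \<bullet> (V *v e)) + 1 / 2 * (w \<bullet> (V *v w))"
    unfolding nV az by (simp add: matrix_vector_mult_diff_distrib inner_diff inner_commute[of "V *v e" w] algebra_simps)
  moreover have "0 < w \<bullet> (V *v w)" using pos \<open>z \<noteq> p\<close> by (simp add: w_def)
  ultimately show "ereal (1 / 2 * (norm_V V (a - p))\<^sup>2) + g p < ereal (1 / 2 * (norm_V V (a - z))\<^sup>2) + g z"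
    by (intro subgradient_quadratic_strict_min[OF sub]) (simp add: e_def w_def nV)
qed

lemma diagonal_plus_rank_one_mult:
  fixes D :: "real^'n^'n" and d u y :: "real^'n"
  assumes "\<And>i j. i \<noteq> j \<Longrightarrow> D $ i $ j = 0" "\<And>i. D $ i $ i = d $ i"
  shows "(D + (columnvector u :: real^1^'n) ** transpose (columnvector u)) *v y
    = (\<chi> i. d $ i * y $ i) + (u \<bullet> y) *\<^sub>R u"
proof -
  have D: "D $ i $ j = (if i = j then d $ i else 0)" for i j using assms by auto
  show ?thesis
    by (simp add: vec_eq_iff matrix_vector_mult_def matrix_matrix_mult_def columnvector_def
        transpose_def D mult_delta_left mult_delta_right distrib_left distrib_right sum.distrib
        inner_vec_def sum_distrib_left sum_distrib_right mult_ac)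
qed

lemma diagonal_plus_rank_one_symmetric:
  fixes D :: "real^'n^'n" and u :: "real^'n"
  assumes "\<And>i j. i \<noteq> j \<Longrightarrow> D $ i $ j = 0"
  shows "transpose (D + (columnvector u :: real^1^'n) ** transpose (columnvector u))
    = D + (columnvector u :: real^1^'n) ** transpose (columnvector u)"
proof -
  have "D $ i $ j = D $ j $ i" for i j using assms by metis
  then show ?thesis
    by (simp add: vec_eq_iff transpose_def matrix_matrix_mult_def columnvector_def mult.commute)
qed

lemma diagonal_plus_rank_one_pos:
  fixes d u y :: "real^'n"
  assumes d: "\<And>i. 0 < d $ i" and "y \<noteq> 0"
  shows "0 < y \<bullet> ((\<chi> i. d $ i * y $ i) + (u \<bullet> y) *\<^sub>R u)"
proof -
  obtain k where k: "y $ k \<noteq> 0" using \<open>y \<noteq> 0\<close> by (auto simp: vec_eq_iff)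
  have "0 < y \<bullet> (\<chi> i. d $ i * y $ i)"
    unfolding inner_vec_def
  proof (rule sum_pos2[of _ k])
    show "0 < y $ k \<bullet> (\<chi> i. d $ i * y $ i) $ k"
      using d[of k] k by (simp add: mult.left_commute zero_less_mult_iff[of "d $ k"])
         (metis not_real_square_gt_zero)
    show "0 \<le> y $ i \<bullet> (\<chi> i. d $ i * y $ i) $ i" for i
      using d[of i] by (simp add: mult.left_commute[of _ "d $ i"])
  qed simp_all
  moreover have "0 \<le> y \<bullet> ((u \<bullet> y) *\<^sub>R u)" by (simp add: inner_commute)
  ultimately show ?thesis by (simp add: inner_add_right)
qed

section \<open>Reduction to a scalar equation\<close>

text \<open>
  Slope at least 1 forces a change of sign within distance \<open>\<bar>p 0\<bar>\<close> of the origin.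
\<close>

lemma expansive_continuous_has_root:
  fixes p :: "real \<Rightarrow> real"
  assumes cont: "continuous_on UNIV p"
    and exp: "\<And>a b. b \<le> a \<Longrightarrow> a - b \<le> p a - p b"
  shows "\<exists>r. p r = 0"
proof -
  let ?M = "\<bar>p 0\<bar>"
  have "p (- ?M) \<le> 0" "0 \<le> p ?M" using exp[of "- ?M" 0] exp[of 0 ?M] by linarith+
  then show ?thesis
    using IVT'[of p "- ?M" 0 ?M] continuous_on_subset[OF cont] by auto
qed

theorem corollary9:
  fixes h :: "real^'n \<Rightarrow> ereal"
    and hs :: "'n \<Rightarrow> real \<Rightarrow> ereal"
    and D V :: "real^'n^'n"
    and d u x :: "real^'n"
    and p :: "real \<Rightarrow> real"
  assumes h_Gamma0: "h \<in> Gamma0"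
    and hs_Gamma0: "\<And>i. hs i \<in> Gamma0"
    and h_separable: "\<And>y. h y = (\<Sum>i\<in>UNIV. hs i (y $ i))"
    and D_offdiag: "\<And>i j. i \<noteq> j \<Longrightarrow> D $ i $ j = 0"
    and D_diag: "\<And>i. D $ i $ i = d $ i"
    and d_pos: "\<And>i. d $ i > 0"
    and V_eq: "V = D + (columnvector u :: real^1^'n) ** transpose (columnvector u)"
    and p_eq: "\<And>\<alpha>. p \<alpha> =
      u \<bullet> (x - (\<chi> i. prox (\<lambda>t. hs i t / ereal (d $ i)) (x $ i - \<alpha> * u $ i / d $ i))) + \<alpha>"
  shows "(\<exists>L. L-lipschitz_on UNIV p) \<and> strict_mono p \<and>
    (\<exists>\<alpha>s. p \<alpha>s = 0 \<and> (\<forall>\<beta>. p \<beta> = 0 \<longrightarrow> \<beta> = \<alpha>s) \<and>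
      (let v = \<alpha>s *\<^sub>R u in
        prox_V V h x =
          (\<chi> i. prox (\<lambda>t. hs i t / ereal (d $ i)) (x $ i - v $ i / d $ i))))"
proof -
  define P where "P i = prox (\<lambda>t. hs i t / ereal (d $ i))" for i
  define arg where "arg i \<alpha> = x $ i - \<alpha> * u $ i / d $ i" for i \<alpha>
  have G: "(\<lambda>t. hs i t / ereal (d $ i)) \<in> Gamma0" for i
    by (rule Gamma0_divide[OF hs_Gamma0 d_pos])
  have p_diff: "p a - p b = (a - b) - (\<Sum>i\<in>UNIV. u $ i * (P i (arg i a) - P i (arg i b)))" for a b
    unfolding p_eq P_def[symmetric] arg_def[symmetric]
    by (simp add: inner_vec_def sum_subtractf algebra_simps)
  have arg_diff: "arg i a - arg i b = - (a - b) * (u $ i / d $ i)" for i a b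
    by (simp add: arg_def algebra_simps diff_divide_distrib)
  \<comment> \<open>The argument moves against the sign of \<open>u $ i\<close> as the parameter grows, and a proximal map on the line is nondecreasing.\<close>
  have term_sign: "u $ i * (P i (arg i a) - P i (arg i b)) \<le> 0" if "b \<le> a" for i a b
  proof (cases "a = b")
    case False
    have "0 \<le> (arg i a - arg i b) * (P i (arg i a) - P i (arg i b))"
      using prox_firmly_nonexpansive[OF G[of i], of "arg i a" "arg i b"]
        order_trans[OF zero_le_power2] unfolding P_def inner_real_def by blast
    also have "\<dots> = - ((a - b) / d $ i) * (u $ i * (P i (arg i a) - P i (arg i b)))"
      unfolding arg_diff by (simp add: algebra_simps diff_divide_distrib)
    finally show ?thesis
      using False that d_pos[of i] by (simp add: zero_le_mult_iff divide_le_0_iff mult_le_0_iff)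
  qed simp
  have expansive: "a - b \<le> p a - p b" if "b \<le> a" for a b
    unfolding p_diff using sum_nonpos[of UNIV "\<lambda>i. u $ i * (P i (arg i a) - P i (arg i b))"]
      term_sign[OF that] by simp
  have mono: "strict_mono p"
  proof (rule strict_monoI)
    fix b a :: real assume "b < a"
    then show "p b < p a" using expansive[of b a] by simp
  qed
  \<comment> \<open>The argument moves at speed \<open>\<bar>u $ i\<bar> / d $ i\<close>; the inner product contributes the second factor \<open>\<bar>u $ i\<bar>\<close>.\<close>
  define L where "L = 1 + (\<Sum>i\<in>UNIV. (u $ i)\<^sup>2 / d $ i)"
  have lip: "L-lipschitz_on UNIV p"
  proof (rule lipschitz_onI)
    show "0 \<le> L" unfolding L_def using d_pos by (simp add: sum_nonneg less_imp_le)
    fix a b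
    have "\<bar>u $ i * (P i (arg i a) - P i (arg i b))\<bar> \<le> (u $ i)\<^sup>2 / d $ i * \<bar>a - b\<bar>" for i
    proof -
      have "\<bar>P i (arg i a) - P i (arg i b)\<bar> \<le> \<bar>arg i a - arg i b\<bar>"
        using prox_nonexpansive[OF G[of i]] unfolding P_def by simp
      then have "\<bar>u $ i\<bar> * \<bar>P i (arg i a) - P i (arg i b)\<bar> \<le> \<bar>u $ i\<bar> * \<bar>arg i a - arg i b\<bar>"
        by (rule mult_left_mono) simp
      also have "\<dots> = (u $ i)\<^sup>2 / d $ i * \<bar>a - b\<bar>"
        unfolding arg_diff using d_pos[of i] by (simp add: abs_mult power2_eq_square abs_minus_commute)
      finally show ?thesis by (simp add: abs_mult)
    qed
    then have "\<bar>\<Sum>i\<in>UNIV. u $ i * (P i (arg i a) - P i (arg i b))\<bar>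
        \<le> (\<Sum>i\<in>UNIV. (u $ i)\<^sup>2 / d $ i) * \<bar>a - b\<bar>"
      unfolding sum_distrib_right by (intro order_trans[OF sum_abs] sum_mono)
    then show "dist (p a) (p b) \<le> L * dist a b"
      unfolding dist_real_def p_diff L_def distrib_right mult_1
      by (intro order_trans[OF abs_triangle_ineq4] add_left_mono)
  qed
  have V_mult: "V *v y = (\<chi> i. d $ i * y $ i) + (u \<bullet> y) *\<^sub>R u" for y
    unfolding V_eq by (rule diagonal_plus_rank_one_mult[OF D_offdiag D_diag])
  obtain r where r: "p r = 0"
    using expansive_continuous_has_root[OF lipschitz_on_continuous_on[OF lip] expansive] by blast
  define z where "z = (\<chi> i. P i (arg i r))"
  \<comment> \<open>The equation \<open>p r = 0\<close>, solved for the scalar that couples the coordinates of \<open>V *v (x - z)\<close>.\<close>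
  have "u \<bullet> (x - z) = - r"
    using r unfolding p_eq P_def[symmetric] arg_def[symmetric] z_def by simp
  moreover have "d $ i * (arg i r - z $ i) = d $ i * (x - z) $ i - r * u $ i" for i
    using d_pos[of i] by (simp add: arg_def right_diff_distrib)
  ultimately have Vz: "V *v (x - z) = (\<chi> i. d $ i *\<^sub>R (arg i r - z $ i))"
    unfolding V_mult by (simp add: vec_eq_iff)
  have "subgradient_at (hs i) (d $ i *\<^sub>R (arg i r - z $ i)) (z $ i)" for i
    using Gamma0_prox_subgradient[OF G[of i], of "arg i r"]
    unfolding subgradient_divide_iff[OF d_pos[of i]] by (simp add: z_def P_def)
  then have "subgradient_at h (V *v (x - z)) z"
    unfolding h_separable[abs_def] Vz by (intro subgradient_separable) simp
  moreover have "0 < y \<bullet> (V *v y)" if "y \<noteq> 0" for y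
    unfolding V_mult using diagonal_plus_rank_one_pos[OF d_pos that] .
  moreover have "transpose V = V"
    unfolding V_eq by (rule diagonal_plus_rank_one_symmetric[OF D_offdiag])
  ultimately have "prox_V V h x = z"
    by (intro prox_V_eqI)
  then have "prox_V V h x = (\<chi> i. prox (\<lambda>t. hs i t / ereal (d $ i)) (x $ i - (r *\<^sub>R u) $ i / d $ i))"
    by (simp add: z_def P_def arg_def)
  moreover have "\<forall>\<beta>. p \<beta> = 0 \<longrightarrow> \<beta> = r"
    using mono r by (metis strict_mono_eq)
  ultimately show ?thesis using lip mono r unfolding Let_def by blast
qed

end
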